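(* Let $X=(X,+,\cdot)$ be a finite left nilpotent skew brace and let $\pi$ be a set of primes. Then the following hold: (a) If $H$ is a Hall $\pi$-subgroup of the multiplicative group $(X,\cdot)$, then $H$ is a Hall $\pi$-subbrace of $X$. (b) For every prime $p$ dividing $|X|$, every Sylow $p$-subgroup of $(X,\cdot)$ is a Sylow $p$-subbrace of $X$. (c) For every prime $p$ dividing $|X|$, every $p$-subbrace of $X$ is contained in a Sylow $p$-subbrace of $X$.
   Context: A skew (left) brace is a triple $(X,+,\cdot)$ where $(X,+)$ and $(X,\cdot)$ are groups (neither assumed abelian) such that $x\cdot(y+z)=x\cdot y-x+x\cdot z$ for all $x,y,z\in X$. The two groups have the same identity element, denoted $0$. $(X,+)$ is the additive group and $(X,\cdot)$ the multiplicative group. A nonempty subset $S\subseteq X$ is a subbrace if it is a subgroup of both $(X,+)$ and $(X,\cdot)$. The star operation is $x*y=-x+x\cdot y-y$. The left series of $X$ is defined by $X^1=X$ and $X^{n+1}=X*X^n$, the subgroup of $(X,+)$ generated by all $a*x$ with $a\in X$, $x\in X^n$. $X$ is left nilpotent if $X^m=0$ (i.e. $X^m=\{0\}$) for some positive integer $m$. For a finite skew brace $X$ and a prime $p$ dividing $|X|$: a $p$-subbrace is a subbrace of order a power of $p$; a Sylow $p$-subbrace is a subbrace of order $|X|_p$, the $p$-part of $|X|$. For a set of primes $\pi$, a Hall $\pi$-subbrace is a subbrace whose order is the largest $\pi$-number dividing $|X|$ (a $\pi$-number is a positive integer all of whose prime divisors lie in $\pi$). A Hall $\pi$-subgroup of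 a finite group is a subgroup whose order is the largest $\pi$-number dividing the group order. *)

theory Defs
  imports "HOL-Algebra.Algebra"
begin

text \<open>
  A skew brace is carried by the record type of rings, used only as a signature: the
  multiplicative group is the record itself seen as a monoid (identity \<open>\<one>\<close>), the additive
  group is \<^const>\<open>add_monoid\<close> of it (identity \<open>\<zero>\<close>). Neither operation is assumed commutative.
\<close>

locale skew_brace =
  fixes B (structure)
  assumes mult_group: "group B"
    and add_group: "group (add_monoid B)"
    and brace_distrib:
      "\<lbrakk>x \<in> carrier B; y \<in> carrier B; z \<in> carrier B\<rbrakk>
        \<Longrightarrow> x \<otimes> (y \<oplus> z) = x \<otimes> y \<ominus> x \<oplus> x \<otimes> z"

lemma (in skew_brace) zero_eq_one: "\<zero> = \<one>"
proof -
  interpret M: group B by (rule mult_group)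
  interpret A: group "add_monoid B" by (rule add_group)
  have z: "\<zero> \<in> carrier B" using A.one_closed by simp
  have o: "\<one> \<in> carrier B" by simp
  have "\<one> \<otimes> (\<zero> \<oplus> \<zero>) = \<one> \<otimes> \<zero> \<ominus> \<one> \<oplus> \<one> \<otimes> \<zero>"
    using brace_distrib[OF o z z] .
  moreover have "\<zero> \<oplus> \<zero> = \<zero>" using A.l_one[of "\<zero>"] z by simp
  ultimately have "\<zero> = (\<zero> \<ominus> \<one>) \<oplus> \<zero>" using z by simp
  moreover have n: "\<ominus> \<one> \<in> carrier B"
    using A.inv_closed[of "\<one>"] o by (simp add: a_inv_def)
  moreover have "\<zero> \<ominus> \<one> = \<ominus> \<one>"
    using A.l_one[of "\<ominus> \<one>"] n by (simp add: a_minus_def)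
  ultimately have "\<ominus> \<one> = \<zero>" using A.r_one[of "\<ominus> \<one>"] by simp
  then have "inv\<^bsub>add_monoid B\<^esub> \<one> = \<one>\<^bsub>add_monoid B\<^esub>" by (simp add: a_inv_def)
  then show ?thesis using A.inv_eq_1_iff[of "\<one>"] o by simp
qed

definition subbrace :: "'a set \<Rightarrow> ('a, 'b) ring_scheme \<Rightarrow> bool"
  where "subbrace S B \<longleftrightarrow> subgroup S (add_monoid B) \<and> subgroup S B"

definition star :: "('a, 'b) ring_scheme \<Rightarrow> 'a \<Rightarrow> 'a \<Rightarrow> 'a"
  where "star B x y = \<ominus>\<^bsub>B\<^esub> x \<oplus>\<^bsub>B\<^esub> x \<otimes>\<^bsub>B\<^esub> y \<ominus>\<^bsub>B\<^esub> y"

definition star_product :: "('a, 'b) ring_scheme \<Rightarrow> 'a set \<Rightarrow> 'a set \<Rightarrow> 'a set"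
  where "star_product B S T =
    generate (add_monoid B) {star B s t | s t. s \<in> S \<and> t \<in> T}"

text \<open>The left series starts at index 1; the value at 0 is a dummy.\<close>

fun left_series :: "('a, 'b) ring_scheme \<Rightarrow> nat \<Rightarrow> 'a set"
  where
    "left_series B 0 = carrier B"
  | "left_series B (Suc 0) = carrier B"
  | "left_series B (Suc (Suc n)) = star_product B (carrier B) (left_series B (Suc n))"

definition left_nilpotent :: "('a, 'b) ring_scheme \<Rightarrow> bool"
  where "left_nilpotent B \<longleftrightarrow> (\<exists>m\<ge>1. left_series B m = {\<zero>\<^bsub>B\<^esub>})"

definition pi_number :: "nat set \<Rightarrow> nat \<Rightarrow> bool"
  where "pi_number \<pi> n \<longleftrightarrow> n > 0 \<and> (\<forall>p. Factorial_Ring.prime p \<and> p dvd n \<longrightarrow> p \<in> \<pi>)"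

definition pi_part :: "nat set \<Rightarrow> nat \<Rightarrow> nat"
  where "pi_part \<pi> n = Max {d. d dvd n \<and> pi_number \<pi> d}"

definition hall_subgroup :: "nat set \<Rightarrow> 'a set \<Rightarrow> ('a, 'b) monoid_scheme \<Rightarrow> bool"
  where "hall_subgroup \<pi> H G \<longleftrightarrow> subgroup H G \<and> card H = pi_part \<pi> (order G)"

definition hall_subbrace :: "nat set \<Rightarrow> 'a set \<Rightarrow> ('a, 'b) ring_scheme \<Rightarrow> bool"
  where "hall_subbrace \<pi> H B \<longleftrightarrow> subbrace H B \<and> card H = pi_part \<pi> (order B)"

definition sylow_subgroup :: "nat \<Rightarrow> 'a set \<Rightarrow> ('a, 'b) monoid_scheme \<Rightarrow> bool"
  where "sylow_subgroup p P G \<longleftrightarrow> subgroup P G \<and> card P = p ^ multiplicity p (order G)"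

definition sylow_subbrace :: "nat \<Rightarrow> 'a set \<Rightarrow> ('a, 'b) ring_scheme \<Rightarrow> bool"
  where "sylow_subbrace p P B \<longleftrightarrow> subbrace P B \<and> card P = p ^ multiplicity p (order B)"

definition p_subbrace :: "nat \<Rightarrow> 'a set \<Rightarrow> ('a, 'b) ring_scheme \<Rightarrow> bool"
  where "p_subbrace p S B \<longleftrightarrow> subbrace S B \<and> (\<exists>k. card S = p ^ k)"

end

theory Submission
  imports Defs
begin

text \<open>
  With \<open>\<lambda>\<^sub>x(y) = -x + x y\<close> the multiplicative group acts on the additive one by automorphisms, and left
  nilpotency says that this action stabilises the series \<open>X = X\<^sup>1 \<ge> X\<^sup>2 \<ge> \<dots>\<close>, in which each term is
  additively normal in the previous one. Hence, for a subgroup \<open>H\<close> of \<open>(X, \<cdot>)\<close> whose order is a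
  \<open>\<pi>\<close>-number, \<open>0 \<times> H\<close> is subnormal in the semidirect product \<open>X \<rtimes> H\<close> and therefore contained in a normal
  \<open>\<pi>\<close>-subgroup \<open>N\<close>. Multiplying \<open>N\<close> by the diagonal copy of \<open>H\<close> gives a \<open>\<pi>\<close>-group that contains
  \<open>H \<times> 0\<close>, so \<open>H\<close> lies in an additive \<open>\<pi>\<close>-subgroup; if \<open>H\<close> is a Hall subgroup, the two
  coincide by order.
\<close>

subsection \<open>\<open>\<pi>\<close>-subgroups\<close>

lemma pi_number_1: "pi_number \<pi> 1"
  by (auto simp: pi_number_def)

lemma pi_number_mult: "pi_number \<pi> m \<Longrightarrow> pi_number \<pi> n \<Longrightarrow> pi_number \<pi> (m * n)"
  by (auto simp: pi_number_def prime_dvd_mult_iff)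

lemma pi_number_dvd: "pi_number \<pi> n \<Longrightarrow> m dvd n \<Longrightarrow> pi_number \<pi> m"
  unfolding pi_number_def by (meson dvd_pos_nat dvd_trans)

lemma pi_number_singleton_power: "pi_number {p} (p ^ k)" if "Factorial_Ring.prime p"
  using that by (auto simp: pi_number_def prime_gt_0_nat dest: prime_dvd_power primes_dvd_imp_eq)

lemma pi_number_singleton_imp_power:
  assumes "pi_number {p} n" and "Factorial_Ring.prime p"
  shows "\<exists>k. n = p ^ k"
proof -
  have "n > 0" using assms by (simp add: pi_number_def)
  obtain m where m: "n = p ^ multiplicity p n * m" "\<not> p dvd m"
    using multiplicity_decompose'[of n p] \<open>n > 0\<close> assms(2)
    by (metis bot_nat_0.not_eq_extremum not_prime_unit)
  have "m = 1"
  proof (rule ccontr)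
    assume "m \<noteq> 1"
    then obtain q where q: "Factorial_Ring.prime q" "q dvd m" using prime_factor_nat by blast
    then have "q dvd n" using m(1) by (metis dvd_mult)
    then show False using q m(2) assms(1) by (auto simp: pi_number_def)
  qed
  then show ?thesis using m(1) by (metis mult.right_neutral)
qed

text \<open>The second isomorphism theorem identifies \<open>S / (N \<inter> S)\<close> with
  \<open>NS / N\<close>; Lagrange on both sides turns this into the product formula.\<close>

lemma (in group) card_normal_set_mult:
  assumes "N \<lhd> G" and "subgroup S G"
  shows "card (N <#> S) * card (N \<inter> S) = card N * card S"
proof -
  interpret second_isomorphism_grp N G S
    using assms by (simp add: second_isomorphism_grp_def second_isomorphism_grp_axioms_def)
  let ?K = "G\<lparr>carrier := N <#> S\<rparr>" and ?S = "G\<lparr>carrier := S\<rparr>"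
  interpret K: group ?K by (rule subgroup_imp_group[OF normal_set_mult_subgroup])
  interpret S: group ?S by (rule subgroup_imp_group[OF assms(2)])
  have sN: "subgroup N ?K"
    by (rule subgroup_incl[OF normal_imp_subgroup[OF assms(1)] normal_set_mult_subgroup H_contained_in_set_mult])
  have sI: "subgroup (N \<inter> S) ?S"
    using normal_imp_subgroup[OF normal_subgrp_intersection_normal] by (simp add: Int_commute)
  have "card (carrier (?S Mod (N \<inter> S))) = card (carrier (?K Mod N))"
    using normal_intersection_quotient_isom bij_betw_same_card unfolding iso_def by blast
  then have c: "card (rcosets\<^bsub>?S\<^esub> (N \<inter> S)) = card (rcosets\<^bsub>?K\<^esub> N)"
    by (simp add: FactGroup_def)
  have "card (rcosets\<^bsub>?S\<^esub> (N \<inter> S)) * card (N \<inter> S) = card S"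
    using S.lagrange[OF sI] by (simp add: order_def)
  moreover have "card (rcosets\<^bsub>?K\<^esub> N) * card N = card (N <#> S)"
    using K.lagrange[OF sN] by (simp add: order_def)
  ultimately show ?thesis using c by (metis mult.assoc mult.commute)
qed

lemma (in group) pi_number_normal_set_mult:
  assumes "N \<lhd> G" and "subgroup S G" and "pi_number \<pi> (card N)" and "pi_number \<pi> (card S)"
  shows "pi_number \<pi> (card (N <#> S))"
  by (rule pi_number_dvd[OF pi_number_mult[OF assms(3,4)]])
    (metis card_normal_set_mult[OF assms(1,2)] dvd_triv_left)

text \<open>A normal \<pi>-subgroup \<open>N\<close> of greatest order absorbs every other one
  \<open>M\<close>: the product \<open>NM\<close> is again normal with order a \<pi>-number, so it
  cannot exceed \<open>N\<close>.\<close>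

lemma (in group) largest_normal_pi_subgroup:
  assumes "finite (carrier G)"
  obtains N where "N \<lhd> G" and "pi_number \<pi> (card N)"
    and "\<And>M. M \<lhd> G \<Longrightarrow> pi_number \<pi> (card M) \<Longrightarrow> M \<subseteq> N"
proof -
  let ?P = "\<lambda>N. N \<lhd> G \<and> pi_number \<pi> (card N)"
  have "?P {\<one>}" using one_is_normal pi_number_1[of \<pi>] by simp
  moreover have "\<forall>N. ?P N \<longrightarrow> card N \<le> card (carrier G)"
    using assms by (auto intro!: card_mono dest: normal_imp_subgroup subgroup.subset)
  ultimately obtain N where N: "?P N" and max: "\<And>M. ?P M \<Longrightarrow> card M \<le> card N"
    using ex_has_greatest_nat[of ?P "{\<one>}" card "card (carrier G) + 1"] by (metis less_Suc_eq_le Suc_eq_plus1)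
  have "M \<subseteq> N" if M: "M \<lhd> G" "pi_number \<pi> (card M)" for M
  proof -
    have sM: "subgroup M G" by (rule normal_imp_subgroup[OF M(1)])
    interpret second_isomorphism_grp N G M
      using N sM by (simp add: second_isomorphism_grp_def second_isomorphism_grp_axioms_def)
    have "?P (N <#> M)"
      using N M sM normal_subgroup_set_mult_closed pi_number_normal_set_mult by blast
    then have "card (N <#> M) \<le> card N" by (rule max)
    moreover have "finite (N <#> M)"
      using assms normal_set_mult_subgroup finite_subset subgroup.subset by blast
    ultimately have "N = N <#> M" using H_contained_in_set_mult by (simp add: card_seteq)
    then show ?thesis using S_contained_in_set_mult by simp
  qed
  with N that show ?thesis by blast
qed

text \<open>The largest normal \<open>\<pi>\<close>-subgroup of \<open>L\<close> is characteristic in \<open>L\<close>, hence normal in \<open>G\<close>.\<close>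

lemma (in group) normal_pi_subgroup_of_normal:
  assumes fin: "finite (carrier G)" and L: "L \<lhd> G"
    and N: "N \<lhd> G\<lparr>carrier := L\<rparr>" "pi_number \<pi> (card N)"
  obtains M where "M \<lhd> G" and "pi_number \<pi> (card M)" and "N \<subseteq> M"
proof -
  interpret L: normal L G by (rule L)
  have sL: "subgroup L G" by (rule normal_imp_subgroup[OF L])
  interpret GL: group "G\<lparr>carrier := L\<rparr>" by (rule subgroup_imp_group[OF sL])
  have "finite (carrier (G\<lparr>carrier := L\<rparr>))"
    using fin L.subset finite_subset by auto
  then obtain M where M: "M \<lhd> G\<lparr>carrier := L\<rparr>" "pi_number \<pi> (card M)"
    and max: "\<And>K. K \<lhd> G\<lparr>carrier := L\<rparr> \<Longrightarrow> pi_number \<pi> (card K) \<Longrightarrow> K \<subseteq> M"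
    using GL.largest_normal_pi_subgroup[of \<pi>] by blast
  have sM: "subgroup M G" and M_L: "M \<subseteq> L"
    using incl_subgroup[OF sL normal_imp_subgroup[OF M(1)]]
      subgroup.subset[OF normal_imp_subgroup[OF M(1)]] by auto
  have "g \<otimes> x \<otimes> inv g \<in> M" if g: "g \<in> carrier G" and x: "x \<in> M" for g x
  proof -
    let ?c = "\<lambda>x. g \<otimes> x \<otimes> inv g"
    have [simp]: "x \<in> carrier G" if "x \<in> M" for x using that sM subgroup.mem_carrier by fast
    have [simp]: "x \<in> carrier G" if "x \<in> L" for x using that sL subgroup.mem_carrier by fast
    have cL: "?c ` M \<subseteq> L" using M_L L.inv_op_closed2[OF g] by blast
    have inj: "inj_on ?c M" using g by (auto simp: inj_on_def)
    have cancel: "g \<otimes> (inv g \<otimes> y) = y" "inv g \<otimes> (g \<otimes> y) = y" if "y \<in> carrier G" for y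
      using that g by (simp_all flip: m_assoc)
    interpret c: group_hom G G ?c
      using g by (unfold_locales, auto simp: hom_def m_assoc cancel)
    have sub: "subgroup (?c ` M) G" by (rule c.subgroup_img_is_subgroup[OF sM])
    \<comment> \<open>Conjugating \<open>?c m\<close> by \<open>l\<close> is the same as applying
      \<open>?c\<close> to the conjugate of \<open>m\<close> by \<open>?l\<close>, and
      \<open>?l\<close> stays in \<open>L\<close> because \<open>L\<close> is normal. So
      \<open>?c\<close> carries normality in \<open>L\<close> from \<open>M\<close> to its
      image.\<close>
    have cj: "l \<otimes> ?c m \<otimes> inv l \<in> ?c ` M" if l: "l \<in> L" and m: "m \<in> M" for l m
    proof -
      let ?l = "inv g \<otimes> l \<otimes> g"
      have lL: "?l \<in> L" using L.inv_op_closed1[OF g l] .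
      have "?l \<otimes> m \<otimes> inv ?l \<in> M"
        using normal.inv_op_closed2[OF M(1), of ?l m] lL m by (simp add: m_inv_consistent[OF sL])
      moreover have "l \<otimes> ?c m \<otimes> inv l = ?c (?l \<otimes> m \<otimes> inv ?l)"
        using g l m by (simp add: m_assoc inv_mult_group cancel)
      ultimately show ?thesis by blast
    qed
    have "?c ` M \<lhd> G\<lparr>carrier := L\<rparr>"
      unfolding GL.normal_inv_iff
      using subgroup_incl[OF sub sL cL] cj by (auto simp: m_inv_consistent[OF sL])
    moreover have "pi_number \<pi> (card (?c ` M))" using M(2) by (simp add: card_image[OF inj])
    ultimately show ?thesis using max x by blast
  qed
  then have "M \<lhd> G" using sM by (simp add: normal_inv_iff)
  then show ?thesis using that M(2) max N by blast
qed

subsection \<open>Sylow subgroups containing a given \<open>p\<close>-subgroup\<close>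

lemma BijGroup_carrier: "carrier (BijGroup E) = Bij E"
  and BijGroup_mult: "f \<in> Bij E \<Longrightarrow> g \<in> Bij E \<Longrightarrow> f \<otimes>\<^bsub>BijGroup E\<^esub> g = compose E f g"
  by (simp_all add: BijGroup_def)

text \<open>The inverse turns right translation into a left action. The restriction to the cosets
  makes the maps extensional, as \<open>Bij\<close> demands.\<close>

lemma (in group) rcosets_action:
  assumes "subgroup H G"
  shows "group_action G (rcosets H) (\<lambda>g. \<lambda>C \<in> rcosets H. C #> inv g)"
proof -
  have closed: "C #> g \<in> rcosets H" if "C \<in> rcosets H" "g \<in> carrier G" for C g
    using that subgroup.subset[OF assms]
    by (auto simp: RCOSETS_def coset_mult_assoc)
  have sub: "C \<subseteq> carrier G" if "C \<in> rcosets H" for C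
    using that rcosets_subset_PowG[OF assms] by blast
  have bij: "bij_betw (\<lambda>C \<in> rcosets H. C #> inv g) (rcosets H) (rcosets H)"
    if g: "g \<in> carrier G" for g
    using g by (intro bij_betwI[where g = "\<lambda>C. C #> g"])
      (auto simp: closed coset_mult_assoc sub)
  show ?thesis
    unfolding group_action_def group_hom_def group_hom_axioms_def
    using bij group_BijGroup is_group
    by (auto simp: hom_def BijGroup_carrier BijGroup_mult Bij_def compose_def
        coset_mult_assoc sub closed inv_mult_group intro!: restrict_ext)
qed

text \<open>The orbit sizes add up to \<open>card E\<close>, so some orbit has size prime to
  \<open>p\<close>; being a divisor of \<open>p ^ k\<close>, that size is 1.\<close>

lemma (in group_action) p_group_fixed_point:
  assumes "finite E" and p: "Factorial_Ring.prime p" and "order G = p ^ k" and "\<not> p dvd card E"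
  obtains x where "x \<in> E" and "\<And>g. g \<in> carrier G \<Longrightarrow> \<phi> g x = x"
proof -
  have "card E = (\<Sum>orb\<in>orbits G E \<phi>. card orb)"
    using disjoint_sum[OF assms(1), of "\<lambda>_. 1 :: nat"] by simp
  then obtain orb where "orb \<in> orbits G E \<phi>" "\<not> p dvd card orb"
    using assms(4) by (metis dvd_sum)
  then obtain x where x: "x \<in> E" and np: "\<not> p dvd card (orbit G \<phi> x)"
    by (auto simp: orbits_def)
  have "card (orbit G \<phi> x) dvd p ^ k"
    using orbit_stabilizer_theorem[OF x] assms(3) by (metis dvd_triv_left)
  then obtain i where "card (orbit G \<phi> x) = p ^ i"
    using divides_primepow_nat[OF p] by blast
  with np have "card (orbit G \<phi> x) = 1" by (cases i) auto
  then obtain y where "orbit G \<phi> x = {y}" by (rule card_1_singletonE)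
  moreover have "x \<in> orbit G \<phi> x" using orbit_refl[OF x] by simp
  moreover have "\<phi> g x \<in> orbit G \<phi> x" if "g \<in> carrier G" for g
    using that unfolding orbit_def by blast
  ultimately have "\<phi> g x = x" if "g \<in> carrier G" for g
    using that by (metis singletonD)
  with x that show ?thesis by blast
qed

text \<open>Let \<open>S\<close> act on the cosets of a Sylow subgroup \<open>Q\<close>. Their
  number is prime to \<open>p\<close>, so \<open>S\<close> fixes some coset \<open>Q x\<close> and
  therefore lies in the conjugate \<open>inv x Q x\<close>.\<close>

lemma (in group) p_subgroup_subset_sylow:
  assumes fin: "finite (carrier G)" and p: "Factorial_Ring.prime p"
    and S: "subgroup S G" "card S = p ^ k"
  obtains P where "subgroup P G" and "card P = p ^ multiplicity p (order G)" and "S \<subseteq> P"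
proof -
  have pos: "order G \<noteq> 0" using fin order_gt_0_iff_finite by simp
  have "p ^ multiplicity p (order G) dvd order G" by (rule multiplicity_dvd)
  then obtain m where m: "order G = p ^ multiplicity p (order G) * m" by (rule dvdE)
  then obtain Q where Q: "subgroup Q G" "card Q = p ^ multiplicity p (order G)"
    using sylow_thm[OF p is_group m fin] by blast
  have "card (rcosets Q) * card Q = order G" by (rule lagrange[OF Q(1)])
  then have np: "\<not> p dvd card (rcosets Q)"
  proof (rule contrapos_pn)
    assume "p dvd card (rcosets Q)"
    then have "p ^ Suc (multiplicity p (order G)) dvd card (rcosets Q) * card Q"
      using Q(2) by (simp add: mult_dvd_mono)
    then show "card (rcosets Q) * card Q \<noteq> order G"
      using pos p by (metis not_prime_unit not_less_eq_eq order_refl power_dvd_iff_le_multiplicity)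
  qed
  interpret group_action G "rcosets Q" "\<lambda>g. \<lambda>C \<in> rcosets Q. C #> inv g"
    by (rule rcosets_action[OF Q(1)])
  interpret S: group_action "G\<lparr>carrier := S\<rparr>" "rcosets Q" "\<lambda>g. \<lambda>C \<in> rcosets Q. C #> inv g"
    by (rule induced_action[OF S(1)])
  have "finite (rcosets Q)"
    using fin rcosets_subset_PowG[OF Q(1)] by (meson finite_Pow_iff finite_subset)
  then obtain C where C: "C \<in> rcosets Q" and fixed: "\<And>s. s \<in> S \<Longrightarrow> C #> inv s = C"
    using S.p_group_fixed_point[OF _ p _ np, of k] S(2) by (auto simp: order_def)
  then obtain x where x: "x \<in> carrier G" "C = Q #> x" by (auto simp: RCOSETS_def)
  let ?c = "\<lambda>y. inv x \<otimes> y \<otimes> x"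
  have cancel: "x \<otimes> (inv x \<otimes> y) = y" "inv x \<otimes> (x \<otimes> y) = y" if "y \<in> carrier G" for y
    using that x(1) by (simp_all flip: m_assoc)
  have Qc: "y \<in> carrier G" if "y \<in> Q" for y using that Q(1) subgroup.mem_carrier by fast
  interpret c: group_hom G G ?c
    using x by (unfold_locales, auto simp: hom_def m_assoc cancel)
  have "inj_on ?c Q" using x Qc by (auto simp: inj_on_def)
  then have "card (?c ` Q) = p ^ multiplicity p (order G)" using Q(2) by (simp add: card_image)
  moreover have "subgroup (?c ` Q) G" by (rule c.subgroup_img_is_subgroup[OF Q(1)])
  moreover have "S \<subseteq> ?c ` Q"
  proof
    fix s assume s: "s \<in> S"
    then have sc: "s \<in> carrier G" using S(1) subgroup.mem_carrier by fast
    have "C #> s = C"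
      using fixed[of "inv s"] s sc subgroup.m_inv_closed[OF S(1) s] by simp
    then have "Q #> (x \<otimes> s) = Q #> x"
      using x sc subgroup.subset[OF Q(1)] by (simp add: coset_mult_assoc)
    then have "x \<otimes> s \<in> Q #> x"
      using rcos_self[OF _ Q(1), of "x \<otimes> s"] x sc by simp
    then obtain q where q: "q \<in> Q" "x \<otimes> s = q \<otimes> x" by (auto simp: r_coset_def)
    then have "s = ?c q" using x sc Qc by (simp add: m_assoc cancel flip: q(2))
    then show "s \<in> ?c ` Q" using q(1) by blast
  qed
  ultimately show ?thesis using that by blast
qed

subsection \<open>The left series under the lambda action\<close>

definition brace_lambda :: "('a, 'b) ring_scheme \<Rightarrow> 'a \<Rightarrow> 'a \<Rightarrow> 'a"
  where "brace_lambda B x y = \<ominus>\<^bsub>B\<^esub> x \<oplus>\<^bsub>B\<^esub> x \<otimes>\<^bsub>B\<^esub> y"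

text \<open>The semidirect product for the action by \<open>brace_lambda\<close>, additive part
  first. It is formed with the whole multiplicative group; restricting the carrier to
  \<open>carrier B \<times> H\<close> gives the version for a subgroup \<open>H\<close>.\<close>

definition brace_semidirect :: "('a, 'b) ring_scheme \<Rightarrow> ('a \<times> 'a) monoid"
  where "brace_semidirect B = \<lparr>carrier = carrier B \<times> carrier B,
    monoid.mult = \<lambda>(a, x) (b, y). (a \<oplus>\<^bsub>B\<^esub> brace_lambda B x b, x \<otimes>\<^bsub>B\<^esub> y),
    one = (\<zero>\<^bsub>B\<^esub>, \<one>\<^bsub>B\<^esub>)\<rparr>"

sublocale skew_brace \<subseteq> mult: group B
  by (rule mult_group)

text \<open>The rewrites let the group facts about \<open>add_monoid B\<close> appear in ring
  notation.\<close>

sublocale skew_brace \<subseteq> add: group "add_monoid B"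
  rewrites "carrier (add_monoid B) = carrier B"
    and "monoid.mult (add_monoid B) = add B"
    and "one (add_monoid B) = \<zero>\<^bsub>B\<^esub>"
    and "m_inv (add_monoid B) = a_inv B"
  by (rule add_group) (auto simp: a_inv_def)

section \<open>The lambda maps as an action on the additive group\<close>

context skew_brace
begin

abbreviation lam where "lam \<equiv> brace_lambda B"

lemma add_cancel:
  assumes "x \<in> carrier B" "y \<in> carrier B"
  shows "x \<oplus> (\<ominus> x \<oplus> y) = y" "\<ominus> x \<oplus> (x \<oplus> y) = y"
  using assms by (simp_all flip: add.m_assoc)

lemma lam_closed [simp]: "x \<in> carrier B \<Longrightarrow> y \<in> carrier B \<Longrightarrow> lam x y \<in> carrier B"
  by (simp add: brace_lambda_def)

lemma mult_eq_add_lam: "x \<in> carrier B \<Longrightarrow> y \<in> carrier B \<Longrightarrow> x \<otimes> y = x \<oplus> lam x y"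
  by (simp add: brace_lambda_def add_cancel)

lemma star_eq: "star B x y = lam x y \<ominus> y"
  by (simp add: star_def brace_lambda_def)

lemma lam_add:
  "x \<in> carrier B \<Longrightarrow> y \<in> carrier B \<Longrightarrow> z \<in> carrier B \<Longrightarrow> lam x (y \<oplus> z) = lam x y \<oplus> lam x z"
  by (simp add: brace_lambda_def brace_distrib a_minus_def add.m_assoc)

lemma lam_one [simp]: "y \<in> carrier B \<Longrightarrow> lam \<one> y = y"
  by (simp add: brace_lambda_def flip: zero_eq_one)

lemma lam_zero [simp]: "x \<in> carrier B \<Longrightarrow> lam x \<zero> = \<zero>"
  by (simp add: brace_lambda_def zero_eq_one)

lemma lam_minus: "x \<in> carrier B \<Longrightarrow> y \<in> carrier B \<Longrightarrow> lam x (\<ominus> y) = \<ominus> lam x y"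
  using lam_add[of x "\<ominus> y" y] by (simp add: add.inv_equality)

text \<open>Expanding \<open>lam y z\<close> and using additivity of \<open>lam x\<close> gives
  \<open>-(lam x y) + lam x (y z)\<close>, that is \<open>-(x y) + x - x + x y z\<close>, where the
  middle terms cancel.\<close>

lemma lam_mult:
  assumes "x \<in> carrier B" "y \<in> carrier B" "z \<in> carrier B"
  shows "lam (x \<otimes> y) z = lam x (lam y z)"
proof -
  have "lam x (lam y z) = \<ominus> lam x y \<oplus> lam x (y \<otimes> z)"
    using assms by (simp add: brace_lambda_def[of B y] lam_add lam_minus)
  then show ?thesis
    using assms by (simp add: brace_lambda_def add.inv_mult_group add.m_assoc add_cancel mult.m_assoc)
qed

section \<open>Invariance and normality of the terms of the left series\<close>

text \<open>The claims feed each other. The inclusion puts \<open>y\<close> in the preceding term,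
  so \<open>star B x y\<close> is one of the generators; then
  \<open>lam x y = star B x y + y\<close> gives invariance, and the same remark gives the next
  inclusion. Indices \<open>Suc n\<close> avoid the dummy value at 0.\<close>

lemma left_series_subgroup_lam:
  "subgroup (left_series B (Suc n)) (add_monoid B) \<and>
    (\<forall>x\<in>carrier B. \<forall>y\<in>left_series B (Suc n). lam x y \<in> left_series B (Suc n)) \<and>
    left_series B (Suc (Suc n)) \<subseteq> left_series B (Suc n)"
proof (induction n)
  case 0
  have "star B s t \<in> carrier B" if "s \<in> carrier B" "t \<in> carrier B" for s t
    using that by (simp add: star_eq a_minus_def)
  then have "star_product B (carrier B) (carrier B) \<subseteq> carrier B"
    unfolding star_product_def by (intro add.generate_incl) auto
  then show ?case using add.subgroup_self by simp
next
  case (Suc n)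
  let ?L = "left_series B (Suc n)" and ?L' = "left_series B (Suc (Suc n))"
  have L: "subgroup ?L (add_monoid B)" "?L' \<subseteq> ?L" using Suc by auto
  have Lc: "y \<in> carrier B" if "y \<in> ?L" for y
    using that subgroup.subset[OF L(1)] by auto
  have gen: "?L' = generate (add_monoid B) {star B s t | s t. s \<in> carrier B \<and> t \<in> ?L}"
    by (simp add: star_product_def)
  have "{star B s t | s t. s \<in> carrier B \<and> t \<in> ?L} \<subseteq> carrier B"
    using Lc by (auto simp: star_eq a_minus_def)
  then have L': "subgroup ?L' (add_monoid B)"
    unfolding gen by (rule add.generate_is_subgroup)
  have star: "star B x y \<in> ?L'" if "x \<in> carrier B" "y \<in> ?L" for x y
    unfolding gen using that by (auto intro!: generate.incl)
  have lam: "lam x y \<in> ?L'" if "x \<in> carrier B" "y \<in> ?L'" for x y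
  proof -
    have "y \<in> ?L" using that L by blast
    then have "lam x y = star B x y \<oplus> y"
      using that(1) Lc by (simp add: star_eq a_minus_def add.m_assoc)
    then show ?thesis
      using star[OF that(1) \<open>y \<in> ?L\<close>] that(2) subgroup.m_closed[OF L'] by simp
  qed
  have "left_series B (Suc (Suc (Suc n))) \<subseteq> ?L'"
    unfolding left_series.simps(3)[of B "Suc n"] star_product_def
  proof (rule add.generate_subgroup_incl[OF _ L'], safe)
    fix s t assume "s \<in> carrier B" "t \<in> ?L'"
    then show "star B s t \<in> ?L'"
      using star L by blast
  qed
  with L' lam show ?case by blast
qed

lemma left_series_subgroup: "subgroup (left_series B (Suc n)) (add_monoid B)"
  and left_series_lam: "x \<in> carrier B \<Longrightarrow> y \<in> left_series B (Suc n) \<Longrightarrow> lam x y \<in> left_series B (Suc n)"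
  and left_series_decreasing: "left_series B (Suc (Suc n)) \<subseteq> left_series B (Suc n)"
  using left_series_subgroup_lam by blast+

lemma left_series_closed: "y \<in> left_series B (Suc n) \<Longrightarrow> y \<in> carrier B"
  using subgroup.subset[OF left_series_subgroup] by auto

lemma star_left_series:
  "x \<in> carrier B \<Longrightarrow> y \<in> left_series B (Suc n) \<Longrightarrow> star B x y \<in> left_series B (Suc (Suc n))"
  by (auto simp: star_product_def intro!: generate.incl)

text \<open>For a generator the identity \<open>y + x*z - y = -(x*y) + x*(y + z)\<close> writes the
  conjugate as a combination of generators, since \<open>y + z\<close> stays in the same term.
  Generation extends this to all \<open>w\<close>.\<close>

lemma left_series_conj:
  assumes y: "y \<in> left_series B (Suc n)" and w: "w \<in> left_series B (Suc (Suc n))"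
  shows "y \<oplus> w \<oplus> \<ominus> y \<in> left_series B (Suc (Suc n))"
proof -
  let ?L = "left_series B (Suc n)" and ?L' = "left_series B (Suc (Suc n))"
  note L' = left_series_subgroup[of "Suc n"]
  have yc: "y \<in> carrier B" using left_series_closed[OF y] .
  have gen: "y \<oplus> star B x z \<oplus> \<ominus> y \<in> ?L'" if x: "x \<in> carrier B" and z: "z \<in> ?L" for x z
  proof -
    have zc: "z \<in> carrier B" using left_series_closed[OF z] .
    have "y \<oplus> z \<in> ?L" using subgroup.m_closed[OF left_series_subgroup y z] by simp
    then have "\<ominus> star B x y \<oplus> star B x (y \<oplus> z) \<in> ?L'"
      using subgroup.m_closed[OF L'] subgroup.m_inv_closed[OF L'] star_left_series x y
      by (metis add.inv_closed a_inv_def monoid.simps(1))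
    also have "\<ominus> star B x y \<oplus> star B x (y \<oplus> z) = y \<oplus> star B x z \<oplus> \<ominus> y"
      using x yc zc by (simp add: star_eq a_minus_def lam_add add.inv_mult_group add.m_assoc add_cancel)
    finally show ?thesis .
  qed
  have "w \<in> generate (add_monoid B) {star B s t | s t. s \<in> carrier B \<and> t \<in> ?L}"
    using w by (simp add: star_product_def)
  \<comment> \<open>Carrier membership is carried through the induction so that the group laws apply
    to the products in case \<open>eng\<close>.\<close>
  then have "w \<in> carrier B \<and> y \<oplus> w \<oplus> \<ominus> y \<in> ?L'"
  proof induction
    case one
    then show ?case using yc subgroup.one_closed[OF L'] by simp
  next
    case (incl h)
    then show ?case using gen left_series_closed yc by (auto simp: star_eq a_minus_def)
  next
    case (inv h)
    then obtain s t where st: "h = star B s t" "s \<in> carrier B" "t \<in> ?L" by blast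
    then have hc: "h \<in> carrier B" using left_series_closed by (auto simp: star_eq a_minus_def)
    have "\<ominus> (y \<oplus> h \<oplus> \<ominus> y) \<in> ?L'"
      using subgroup.m_inv_closed[OF L' gen[OF st(2,3)]] st(1) by (simp add: a_inv_def)
    then show ?case using hc yc by (simp add: add.inv_mult_group add.m_assoc flip: a_inv_def)
  next
    case (eng h1 h2)
    then have "(y \<oplus> h1 \<oplus> \<ominus> y) \<oplus> (y \<oplus> h2 \<oplus> \<ominus> y) \<in> ?L'"
      using subgroup.m_closed[OF L'] by simp
    with eng show ?case using yc by (simp add: add.m_assoc add_cancel)
  qed
  then show ?thesis ..
qed

end

subsection \<open>The semidirect product of the two groups\<close>

context skew_brace
begin

abbreviation SD where "SD \<equiv> brace_semidirect B"

lemma SD_simps [simp]: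
  "carrier SD = carrier B \<times> carrier B"
  "(a, x) \<otimes>\<^bsub>SD\<^esub> (b, y) = (a \<oplus> lam x b, x \<otimes> y)"
  "\<one>\<^bsub>SD\<^esub> = (\<zero>, \<one>)"
  by (simp_all add: brace_semidirect_def)

lemma SD_group: "group SD"
proof (rule groupI)
  fix p assume "p \<in> carrier SD"
  then obtain a x where p: "p = (a, x)" "a \<in> carrier B" "x \<in> carrier B" by auto
  \<comment> \<open>Solving \<open>(b, y) (a, x) = (0, 1)\<close> forces \<open>y = inv x\<close>
    and then \<open>b = -(lam y a)\<close>; \<open>groupI\<close> asks only for this left
    inverse.\<close>
  then have "(lam (inv x) (\<ominus> a), inv x) \<in> carrier SD"
    and "(lam (inv x) (\<ominus> a), inv x) \<otimes>\<^bsub>SD\<^esub> p = \<one>\<^bsub>SD\<^esub>"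
    by (simp_all flip: lam_add)
  then show "\<exists>q\<in>carrier SD. q \<otimes>\<^bsub>SD\<^esub> p = \<one>\<^bsub>SD\<^esub>" by blast
qed (auto simp: lam_add lam_mult add.m_assoc mult.m_assoc)

lemma SD_inv:
  assumes "a \<in> carrier B" "x \<in> carrier B"
  shows "inv\<^bsub>SD\<^esub> (a, x) = (lam (inv x) (\<ominus> a), inv x)"
proof -
  interpret SD: group SD by (rule SD_group)
  show ?thesis using assms by (intro SD.inv_equality) (simp_all flip: lam_add)
qed

lemma left_series_times_subgroup:
  assumes "subgroup H B"
  shows "subgroup (left_series B (Suc n) \<times> H) SD"
proof -
  interpret SD: group SD by (rule SD_group)
  note L = left_series_subgroup[of n]
  have H: "x \<in> carrier B" if "x \<in> H" for x using that assms subgroup.mem_carrier by fast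
  have add: "a \<oplus> b \<in> left_series B (Suc n)"
    if "a \<in> left_series B (Suc n)" "b \<in> left_series B (Suc n)" for a b
    using subgroup.m_closed[OF L] that by simp
  have minus: "\<ominus> a \<in> left_series B (Suc n)" if "a \<in> left_series B (Suc n)" for a
    using subgroup.m_inv_closed[OF L] that by (simp add: a_inv_def)
  show ?thesis
  proof (rule SD.subgroupI)
    show "left_series B (Suc n) \<times> H \<subseteq> carrier SD"
      using H left_series_closed by auto
    show "left_series B (Suc n) \<times> H \<noteq> {}"
      using subgroup.one_closed[OF L] subgroup.one_closed[OF assms] by auto
    fix p assume "p \<in> left_series B (Suc n) \<times> H"
    then obtain a x where p: "p = (a, x)" "a \<in> left_series B (Suc n)" "x \<in> H" by auto
    then show "inv\<^bsub>SD\<^esub> p \<in> left_series B (Suc n) \<times> H"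
      using H left_series_closed subgroup.m_inv_closed[OF assms] minus
      by (simp add: SD_inv left_series_lam del: left_series.simps)
    fix q assume "q \<in> left_series B (Suc n) \<times> H"
    then obtain b y where "q = (b, y)" "b \<in> left_series B (Suc n)" "y \<in> H" by auto
    with p show "p \<otimes>\<^bsub>SD\<^esub> q \<in> left_series B (Suc n) \<times> H"
      using H add subgroup.m_closed[OF assms] by (simp add: left_series_lam del: left_series.simps)
  qed
qed

text \<open>This is one link of the subnormal chain from \<open>{0} \<times> H\<close> up to
  \<open>X \<times> H\<close>. It combines additive normality of consecutive terms with the fact
  that stars of one term land in the next.\<close>

lemma left_series_times_normal:
  assumes "subgroup H B"
  shows "left_series B (Suc (Suc n)) \<times> H \<lhd> SD\<lparr>carrier := left_series B (Suc n) \<times> H\<rparr>"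
proof -
  interpret SD: group SD by (rule SD_group)
  let ?L = "left_series B (Suc n)" and ?L' = "left_series B (Suc (Suc n))"
  note sub = left_series_times_subgroup[OF assms]
  interpret K: group "SD\<lparr>carrier := ?L \<times> H\<rparr>" by (rule SD.subgroup_imp_group[OF sub])
  have H: "x \<in> carrier B" if "x \<in> H" for x using that assms subgroup.mem_carrier by fast
  have "p \<otimes>\<^bsub>SD\<^esub> q \<otimes>\<^bsub>SD\<^esub> inv\<^bsub>SD\<^esub> p \<in> ?L' \<times> H" if pq: "p \<in> ?L \<times> H" "q \<in> ?L' \<times> H" for p q
  proof -
    obtain t h where p: "p = (t, h)" "t \<in> ?L" "h \<in> H" using pq(1) by (rule SigmaE)
    obtain s k where q: "q = (s, k)" "s \<in> ?L'" "k \<in> H" using pq(2) by (rule SigmaE)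
    have c: "t \<in> carrier B" "s \<in> carrier B" "h \<in> carrier B" "k \<in> carrier B"
      using p q H left_series_closed by blast+
    let ?k = "h \<otimes> k \<otimes> inv h"
    have kH: "?k \<in> H"
      using p q assms by (simp add: subgroup.m_closed subgroup.m_inv_closed)
    have "p \<otimes>\<^bsub>SD\<^esub> q \<otimes>\<^bsub>SD\<^esub> inv\<^bsub>SD\<^esub> p = (t \<oplus> lam h s \<oplus> \<ominus> lam ?k t, ?k)"
      using c by (simp add: p(1) q(1) SD_inv lam_minus flip: lam_mult)
    \<comment> \<open>Inserting \<open>-t + t\<close> splits off an additive conjugate, handled by
      \<open>left_series_conj\<close>; what remains, \<open>t - lam ?k t\<close>, is the negative of
      a star.\<close>
    also have "t \<oplus> lam h s \<oplus> \<ominus> lam ?k t = (t \<oplus> lam h s \<oplus> \<ominus> t) \<oplus> \<ominus> star B ?k t"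
      using c by (simp add: star_eq a_minus_def add.inv_mult_group add.m_assoc add_cancel)
    finally have "p \<otimes>\<^bsub>SD\<^esub> q \<otimes>\<^bsub>SD\<^esub> inv\<^bsub>SD\<^esub> p
        = ((t \<oplus> lam h s \<oplus> \<ominus> t) \<oplus> \<ominus> star B ?k t, ?k)" .
    moreover have "(t \<oplus> lam h s \<oplus> \<ominus> t) \<oplus> \<ominus> star B ?k t \<in> ?L'"
    proof -
      have "t \<oplus> lam h s \<oplus> \<ominus> t \<in> ?L'"
        by (rule left_series_conj[OF p(2) left_series_lam[OF c(3) q(2)]])
      moreover have "\<ominus> star B ?k t \<in> ?L'"
        using subgroup.m_inv_closed[OF left_series_subgroup star_left_series[of ?k t n]] c p(2)
        by (simp add: a_inv_def del: left_series.simps)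
      ultimately show ?thesis
        using subgroup.m_closed[OF left_series_subgroup] by (simp del: left_series.simps)
    qed
    ultimately show ?thesis using kH by (simp del: left_series.simps)
  qed
  moreover have "subgroup (?L' \<times> H) (SD\<lparr>carrier := ?L \<times> H\<rparr>)"
    using left_series_decreasing by (intro SD.subgroup_incl sub) blast
  ultimately show ?thesis
    by (simp add: K.normal_inv_iff SD.m_inv_consistent[OF sub] del: left_series.simps)
qed

section \<open>From the subnormal chain to an additive \<pi>-subgroup\<close>

text \<open>Induction up the chain, so downwards in the index from \<open>m\<close>. At
  \<open>m\<close> the group is \<open>{0} \<times> H\<close> itself; each step enlarges
  \<open>N\<close> to a normal \<pi>-subgroup of the next larger group by
  \<open>normal_pi_subgroup_of_normal\<close>.\<close>

lemma normal_pi_subgroup_of_semidirect: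
  assumes fin: "finite (carrier B)" and nil: "left_series B (Suc m) = {\<zero>}"
    and H: "subgroup H B" "pi_number \<pi> (card H)"
  shows "\<exists>N. N \<lhd> SD\<lparr>carrier := carrier B \<times> H\<rparr> \<and> pi_number \<pi> (card N) \<and> {\<zero>} \<times> H \<subseteq> N"
proof -
  interpret SD: group SD by (rule SD_group)
  have HB: "H \<subseteq> carrier B" by (rule subgroup.subset[OF H(1)])
  have "\<exists>N. N \<lhd> SD\<lparr>carrier := left_series B (Suc n) \<times> H\<rparr> \<and> pi_number \<pi> (card N) \<and> {\<zero>} \<times> H \<subseteq> N"
    if "n \<le> m" for n
    using that
  proof (induction n rule: inc_induct)
    case base
    interpret K: group "SD\<lparr>carrier := left_series B (Suc m) \<times> H\<rparr>"
      by (rule SD.subgroup_imp_group[OF left_series_times_subgroup[OF H(1)]])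
    show ?case
      using K.normal_self H(2) unfolding nil by (auto simp: card_cartesian_product intro!: exI[of _ "{\<zero>} \<times> H"])
  next
    case (step n)
    let ?L = "left_series B (Suc n) \<times> H" and ?L' = "left_series B (Suc (Suc n)) \<times> H"
    interpret K: group "SD\<lparr>carrier := ?L\<rparr>"
      by (rule SD.subgroup_imp_group[OF left_series_times_subgroup[OF H(1)]])
    obtain N where N: "N \<lhd> SD\<lparr>carrier := ?L'\<rparr>" "pi_number \<pi> (card N)" "{\<zero>} \<times> H \<subseteq> N"
      using step.IH by blast
    have "?L \<subseteq> carrier B \<times> carrier B" using HB left_series_closed by auto
    then have "finite (carrier (SD\<lparr>carrier := ?L\<rparr>))"
      using fin finite_subset by fastforce
    then obtain M where "M \<lhd> SD\<lparr>carrier := ?L\<rparr>" "pi_number \<pi> (card M)" "N \<subseteq> M"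
      using K.normal_pi_subgroup_of_normal[OF _ left_series_times_normal[OF H(1)], of N \<pi>] N
      by auto
    then show ?case using N(3) by blast
  qed
  from this[of 0] show ?thesis by simp
qed

text \<open>
  \<open>T\<close> is the additive part of \<open>N D\<close>, where \<open>D\<close> is the diagonal of \<open>H\<close>: it contains \<open>H\<close> because
  \<open>(h, h) (\<zero>, h\<^sup>-\<^sup>1) = (h, \<one>)\<close>.
\<close>

lemma pi_subgroup_subset_additive_pi_subgroup:
  assumes fin: "finite (carrier B)" and nil: "left_nilpotent B"
    and H: "subgroup H B" "pi_number \<pi> (card H)"
  obtains T where "subgroup T (add_monoid B)" and "pi_number \<pi> (card T)" and "H \<subseteq> T"
proof -
  interpret SD: group SD by (rule SD_group)
  obtain m where m: "left_series B (Suc m) = {\<zero>}"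
    using nil unfolding left_nilpotent_def by (metis Suc_le_D One_nat_def)
  let ?K = "SD\<lparr>carrier := carrier B \<times> H\<rparr>"
  have sK: "subgroup (carrier B \<times> H) SD"
    using left_series_times_subgroup[OF H(1), of 0] by simp
  interpret K: group ?K by (rule SD.subgroup_imp_group[OF sK])
  obtain N where N: "N \<lhd> ?K" "pi_number \<pi> (card N)" "{\<zero>} \<times> H \<subseteq> N"
    using normal_pi_subgroup_of_semidirect[OF fin m H] by blast
  have Hc: "x \<in> carrier B" if "x \<in> H" for x using that H(1) subgroup.mem_carrier by fast
  let ?D = "(\<lambda>h. (h, h)) ` H"
  have "subgroup ?D ?K"
  proof (rule SD.subgroup_incl[OF SD.subgroupI sK])
    show "?D \<subseteq> carrier SD" "?D \<subseteq> carrier B \<times> H" using Hc by auto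
    show "?D \<noteq> {}" using subgroup.one_closed[OF H(1)] by blast
    show "inv\<^bsub>SD\<^esub> p \<in> ?D" if p: "p \<in> ?D" for p
    proof -
      obtain h where h: "p = (h, h)" "h \<in> H" using p by blast
      \<comment> \<open>The left side is \<open>inv h \<otimes> h\<close>, and \<open>1 = 0\<close>.
        It follows that the inverse of \<open>(h, h)\<close> is the diagonal element
        \<open>(inv h, inv h)\<close>.\<close>
      have "inv h \<oplus> lam (inv h) h = \<one>"
        using h(2) Hc by (simp flip: mult_eq_add_lam)
      then have "lam (inv h) (\<ominus> h) = inv h"
        using h(2) Hc add.inv_equality[of "inv h" "lam (inv h) h"]
        by (simp add: lam_minus zero_eq_one)
      then show ?thesis using h Hc subgroup.m_inv_closed[OF H(1)] by (simp add: SD_inv)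
    qed
    show "p \<otimes>\<^bsub>SD\<^esub> q \<in> ?D" if "p \<in> ?D" "q \<in> ?D" for p q
      using that Hc subgroup.m_closed[OF H(1)] by (auto simp flip: mult_eq_add_lam)
  qed
  then interpret second_isomorphism_grp N ?K ?D
    using N(1) by (simp add: second_isomorphism_grp_def second_isomorphism_grp_axioms_def)
  define U where "U = N <#>\<^bsub>?K\<^esub> ?D"
  have sU: "subgroup U SD"
    using SD.incl_subgroup[OF sK normal_set_mult_subgroup] by (simp add: U_def)
  have "card ?D = card H" by (intro card_image inj_onI) simp
  \<comment> \<open>As \<open>N\<close> is normal, \<open>card U\<close> divides
    \<open>card N * card H\<close>, a product of two \<pi>-numbers.\<close>
  then have piU: "pi_number \<pi> (card U)"
    unfolding U_def using K.pi_number_normal_set_mult[OF N(1) subgrpS N(2)] H(2) by simp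
  define T where "T = {a \<in> carrier B. (a, \<one>) \<in> U}"
  \<comment> \<open>Since \<open>lam 1\<close> is the identity,
    \<open>(a, 1) (b, 1) = (a + b, 1)\<close>: on this slice the semidirect operation is addition,
    so \<open>T\<close> inherits the additive subgroup laws from
    \<open>T \<times> {1}\<close>.\<close>
  have sT1: "subgroup (T \<times> {\<one>}) SD"
  proof (rule SD.subgroupI)
    show "T \<times> {\<one>} \<subseteq> carrier SD" by (auto simp: T_def)
    show "T \<times> {\<one>} \<noteq> {}" using subgroup.one_closed[OF sU] by (auto simp: T_def)
    show "inv\<^bsub>SD\<^esub> p \<in> T \<times> {\<one>}" if "p \<in> T \<times> {\<one>}" for p
      using that subgroup.m_inv_closed[OF sU, of p] by (auto simp: T_def SD_inv)
    show "p \<otimes>\<^bsub>SD\<^esub> q \<in> T \<times> {\<one>}" if "p \<in> T \<times> {\<one>}" "q \<in> T \<times> {\<one>}" for p q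
      using that subgroup.m_closed[OF sU, of p q] by (auto simp: T_def)
  qed
  have "subgroup T (add_monoid B)"
  proof (rule add.subgroupI)
    show "T \<subseteq> carrier B" by (auto simp: T_def)
    show "T \<noteq> {}" using subgroup.one_closed[OF sT1] by auto
    show "\<ominus> a \<in> T" if "a \<in> T" for a
      using subgroup.m_inv_closed[OF sT1, of "(a, \<one>)"] that by (auto simp: SD_inv T_def)
    show "a \<oplus> b \<in> T" if "a \<in> T" "b \<in> T" for a b
      using subgroup.m_closed[OF sT1, of "(a, \<one>)" "(b, \<one>)"] that by (auto simp: T_def)
  qed
  moreover have "pi_number \<pi> (card T)"
  proof (rule pi_number_dvd[OF piU])
    interpret U: group "SD\<lparr>carrier := U\<rparr>" by (rule SD.subgroup_imp_group[OF sU])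
    have "subgroup (T \<times> {\<one>}) (SD\<lparr>carrier := U\<rparr>)"
      by (rule SD.subgroup_incl[OF sT1 sU]) (auto simp: T_def)
    from U.lagrange[OF this] have "card (T \<times> {\<one>}) dvd card U"
      by (simp add: order_def) (metis dvd_triv_right)
    then show "card T dvd card U" by (simp add: card_cartesian_product)
  qed
  moreover have "H \<subseteq> T"
  proof
    fix h assume h: "h \<in> H"
    have "(h, h) \<in> U" using S_contained_in_set_mult h by (auto simp: U_def)
    moreover have "(\<zero>, inv h) \<in> U"
      using H_contained_in_set_mult N(3) subgroup.m_inv_closed[OF H(1) h] unfolding U_def by blast
    ultimately have "(h, h) \<otimes>\<^bsub>SD\<^esub> (\<zero>, inv h) \<in> U" by (rule subgroup.m_closed[OF sU])
    then show "h \<in> T" using h Hc by (simp add: T_def)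
  qed
  ultimately show ?thesis by (rule that)
qed

section \<open>Hall and Sylow subgroups as subbraces\<close>

text \<open>Both groups share one carrier, so the additive \<pi>-subgroup \<open>T\<close>
  containing \<open>H\<close> has order dividing \<open>order B\<close>. Maximality then forces
  \<open>T = H\<close>. Phrasing maximality by divisors serves the Hall and the Sylow case
  alike.\<close>

lemma subbrace_of_maximal_pi_subgroup:
  assumes fin: "finite (carrier B)" and nil: "left_nilpotent B"
    and H: "subgroup H B" "pi_number \<pi> (card H)"
    and max: "\<And>d. d dvd order B \<Longrightarrow> pi_number \<pi> d \<Longrightarrow> d \<le> card H"
  shows "subbrace H B"
proof -
  obtain T where T: "subgroup T (add_monoid B)" "pi_number \<pi> (card T)" "H \<subseteq> T"
    using pi_subgroup_subset_additive_pi_subgroup[OF fin nil H] by blast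
  have "card T dvd order B"
    using add.lagrange[OF T(1)] by (simp add: order_def) (metis dvd_triv_right)
  then have "card T \<le> card H" using T(2) by (rule max)
  moreover have "finite T" using fin subgroup.subset[OF T(1)] finite_subset by auto
  ultimately have "H = T" using T(3) by (simp add: card_seteq)
  then show ?thesis using T(1) H(1) by (simp add: subbrace_def)
qed

lemma hall_subgroup_imp_hall_subbrace:
  assumes fin: "finite (carrier B)" and nil: "left_nilpotent B" and H: "hall_subgroup \<pi> H B"
  shows "hall_subbrace \<pi> H B"
proof -
  let ?D = "{d. d dvd order B \<and> pi_number \<pi> d}"
  have "order B > 0" using fin mult.order_gt_0_iff_finite by simp
  then have D: "finite ?D" by simp
  \<comment> \<open>Nonemptiness makes \<open>Max ?D\<close> a member of \<open>?D\<close>, hence a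
    \<pi>-number.\<close>
  have "1 \<in> ?D" using pi_number_1 by auto
  have cH: "subgroup H B" "card H = Max ?D"
    using H by (simp_all add: hall_subgroup_def pi_part_def)
  have "pi_number \<pi> (card H)"
    using Max_in[OF D] \<open>1 \<in> ?D\<close> unfolding cH(2) by blast
  then have "subbrace H B"
    using D cH by (intro subbrace_of_maximal_pi_subgroup[OF fin nil cH(1)]) auto
  then show ?thesis using H by (simp add: hall_subbrace_def hall_subgroup_def)
qed

lemma sylow_subgroup_imp_sylow_subbrace:
  assumes fin: "finite (carrier B)" and nil: "left_nilpotent B"
    and p: "Factorial_Ring.prime p" and P: "sylow_subgroup p P B"
  shows "sylow_subbrace p P B"
proof -
  have pos: "order B > 0" using fin mult.order_gt_0_iff_finite by simp
  have P': "subgroup P B" "card P = p ^ multiplicity p (order B)"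
    using P by (simp_all add: sylow_subgroup_def)
  \<comment> \<open>The Sylow case is the maximality criterion for the set \<open>{p}\<close>, whose
    numbers are the powers of \<open>p\<close>.\<close>
  have "d \<le> card P" if d: "d dvd order B" "pi_number {p} d" for d
  proof -
    obtain k where k: "d = p ^ k" using pi_number_singleton_imp_power[OF d(2) p] by blast
    then have "k \<le> multiplicity p (order B)"
      using d(1) pos p by (intro multiplicity_geI) auto
    then show ?thesis
      using k P'(2) prime_gt_0_nat[OF p] by (simp add: power_increasing)
  qed
  then have "subbrace P B"
    using pi_number_singleton_power[OF p]
    by (intro subbrace_of_maximal_pi_subgroup[OF fin nil P'(1), of "{p}"]) (simp_all add: P'(2))
  then show ?thesis using P'(2) by (simp add: sylow_subbrace_def)
qed

end

theorem theoremA: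
  fixes B :: "('a, 'b) ring_scheme" and \<pi> :: "nat set"
  assumes "skew_brace B"
    and "finite (carrier B)"
    and "left_nilpotent B"
    and "\<forall>q\<in>\<pi>. Factorial_Ring.prime q"
  shows "(\<forall>H. hall_subgroup \<pi> H B \<longrightarrow> hall_subbrace \<pi> H B)
    \<and> (\<forall>p. Factorial_Ring.prime p \<and> p dvd order B \<longrightarrow>
          (\<forall>P. sylow_subgroup p P B \<longrightarrow> sylow_subbrace p P B))
    \<and> (\<forall>p. Factorial_Ring.prime p \<and> p dvd order B \<longrightarrow>
          (\<forall>S. p_subbrace p S B \<longrightarrow> (\<exists>P. sylow_subbrace p P B \<and> S \<subseteq> P)))"
proof (intro conjI allI impI)
  interpret skew_brace B by (rule assms(1))
  show "hall_subbrace \<pi> H B" if "hall_subgroup \<pi> H B" for H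
    using that by (rule hall_subgroup_imp_hall_subbrace[OF assms(2,3)])
  show sylow: "sylow_subbrace p P B"
    if "Factorial_Ring.prime p \<and> p dvd order B" "sylow_subgroup p P B" for p P
    using that sylow_subgroup_imp_sylow_subbrace[OF assms(2,3)] by blast
  show "\<exists>P. sylow_subbrace p P B \<and> S \<subseteq> P"
    if p: "Factorial_Ring.prime p \<and> p dvd order B" and S: "p_subbrace p S B" for p S
  proof -
    \<comment> \<open>Only the multiplicative structure of \<open>S\<close> is extended:
      \<open>S\<close> lies in a Sylow subgroup \<open>P\<close> of the multiplicative group, and
      the preceding claim makes \<open>P\<close> a subbrace.\<close>
    obtain k where k: "subgroup S B" "card S = p ^ k"
      using S by (auto simp: p_subbrace_def subbrace_def)
    then obtain P where "sylow_subgroup p P B" "S \<subseteq> P"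
      using mult.p_subgroup_subset_sylow[OF assms(2) conjunct1[OF p] k]
      unfolding sylow_subgroup_def by blast
    then show ?thesis using sylow[OF p] by blast
  qed
qed

end
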